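(* For every integer $k\ge 1$, $$f_k(-1)=\sum_{i=0}^{k-1}(-1)^i\,|\mathrm{RedVHC}_k(\mathrm{Av}_{3k-i}(312))| = C_k,$$ where $f_k(x)=\sum_{i=0}^{k-1}|\mathrm{RedVHC}_k(\mathrm{Av}_{3k-i}(312))|\,x^i$ and $C_k=\frac{1}{k+1}\binom{2k}{k}$ is the $k$-th Catalan number.
   Context: $S_n$ is the set of permutations $\pi=\pi_1\cdots\pi_n$ of $\{1,\dots,n\}$. $\pi$ is $312$-avoiding if there are no indices $a<b<c$ with $\pi_b<\pi_c<\pi_a$; $\mathrm{Av}_n(312)\subseteq S_n$ is the set of $312$-avoiding permutations of length $n$. The plot of $\pi$ is the set of points $(i,\pi_i)$, $1\le i\le n$. If $\pi_i>\pi_{i+1}$, then $i$ is a descent, $(i,\pi_i)$ is a descent top and $(i+1,\pi_{i+1})$ is a descent bottom. A hook on $\pi$ from $(i,\pi_i)$ to $(j,\pi_j)$, where $i<j$ and $\pi_i<\pi_j$, consists of the vertical segment from $(i,\pi_i)$ up to $(i,\pi_j)$ followed by the horizontal segment from $(i,\pi_j)$ to $(j,\pi_j)$. The point $(i,\pi_i)$ is its southwest (SW) endpoint and $(j,\pi_j)$ its northeast (NE) endpoint. A valid hook configuration on $\pi$ is a set of hooks on $\pi$ such that: (i) the set of SW endpoints of the hooks is exactly the set of descent tops of $\pi$; (ii) no point of the plot lies directly above a hook (for a hook from $(i,\pi_i)$ to $(j,\pi_j)$ there is no $l$ with $i<l<j$ and $\pi_l>\pi_j$); (iii) distinct hooks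 do not intersect, except at endpoints (the NE endpoint of one hook may be the SW endpoint of another; two hooks sharing the same NE endpoint, or the same SW endpoint, overlap in a segment and are not allowed). It is reduced if every point of the plot is a hook endpoint or a descent bottom (or both). For a set $S$ of permutations, $\mathrm{RedVHC}_k(S)$ is the set of all reduced valid hook configurations with exactly $k$ hooks on permutations in $S$ (a configuration includes the data of its underlying permutation). *)

theory Defs
  imports
    Complex_Main
    "HOL-Combinatorics.Multiset_Permutations"
    "HOL-Computational_Algebra.Polynomial"
begin

text \<open>
  Permutations are in one-line notation: the elements of \<open>permutations_of_set {1..n}\<close>, as lists.
  Positions are list positions, hence run from \<open>0\<close> to \<open>n - 1\<close>, so the plot is translated one unit
  to the left.
\<close>

definition avoids_312 :: "nat list \<Rightarrow> bool" where
  "avoids_312 \<pi> \<longleftrightarrow>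
     \<not> (\<exists>a b c. a < b \<and> b < c \<and> c < length \<pi> \<and> \<pi> ! b < \<pi> ! c \<and> \<pi> ! c < \<pi> ! a)"

definition Av312 :: "nat \<Rightarrow> nat list set" where
  "Av312 n = {\<pi> \<in> permutations_of_set {1..n}. avoids_312 \<pi>}"

definition descents :: "nat list \<Rightarrow> nat set" where
  "descents \<pi> = {i. Suc i < length \<pi> \<and> \<pi> ! i > \<pi> ! Suc i}"

definition plot_point :: "nat list \<Rightarrow> nat \<Rightarrow> real \<times> real" where
  "plot_point \<pi> i = (real i, real (\<pi> ! i))"

text \<open>A hook is encoded by the positions \<open>(i, j)\<close> of its SW and NE endpoints.\<close>

definition is_hook :: "nat list \<Rightarrow> nat \<times> nat \<Rightarrow> bool" where
  "is_hook \<pi> = (\<lambda>(i, j). i < j \<and> j < length \<pi> \<and> \<pi> ! i < \<pi> ! j)"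

definition hook_curve :: "nat list \<Rightarrow> nat \<times> nat \<Rightarrow> (real \<times> real) set" where
  "hook_curve \<pi> = (\<lambda>(i, j).
     {real i} \<times> {real (\<pi> ! i)..real (\<pi> ! j)} \<union> {real i..real j} \<times> {real (\<pi> ! j)})"

definition hook_ends :: "nat list \<Rightarrow> nat \<times> nat \<Rightarrow> (real \<times> real) set" where
  "hook_ends \<pi> = (\<lambda>(i, j). {plot_point \<pi> i, plot_point \<pi> j})"

text \<open>
  The last condition lets two distinct hooks meet only in points that are endpoints of both. Hooks
  with a common SW (or a common NE) endpoint overlap in a segment of positive length, so they are
  excluded by it.
\<close>

definition valid_hook_config :: "nat list \<Rightarrow> (nat \<times> nat) set \<Rightarrow> bool" where
  "valid_hook_config \<pi> H \<longleftrightarrow>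
     (\<forall>h\<in>H. is_hook \<pi> h) \<and>
     fst ` H = descents \<pi> \<and>
     (\<forall>(i, j)\<in>H. \<not> (\<exists>l. i < l \<and> l < j \<and> \<pi> ! l > \<pi> ! j)) \<and>
     (\<forall>h\<in>H. \<forall>h'\<in>H. h \<noteq> h' \<longrightarrow>
        hook_curve \<pi> h \<inter> hook_curve \<pi> h' \<subseteq> hook_ends \<pi> h \<inter> hook_ends \<pi> h')"

definition reduced_hook_config :: "nat list \<Rightarrow> (nat \<times> nat) set \<Rightarrow> bool" where
  "reduced_hook_config \<pi> H \<longleftrightarrow>
     (\<forall>i<length \<pi>. i \<in> fst ` H \<or> i \<in> snd ` H \<or> i \<in> Suc ` descents \<pi>)"

definition RedVHC :: "nat \<Rightarrow> nat list set \<Rightarrow> (nat list \<times> (nat \<times> nat) set) set" where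
  "RedVHC k S =
     {(\<pi>, H). \<pi> \<in> S \<and> valid_hook_config \<pi> H \<and> reduced_hook_config \<pi> H \<and> card H = k}"

text \<open>Only used for \<open>k \<ge> 1\<close>, where the subtractions on \<open>nat\<close> do not truncate.\<close>

definition f_poly :: "nat \<Rightarrow> real poly" where
  "f_poly k = (\<Sum>i=0..k-1. monom (real (card (RedVHC k (Av312 (3 * k - i))))) i)"

definition catalan_number :: "nat \<Rightarrow> real" where
  "catalan_number k = 1 / (real k + 1) * real ((2 * k) choose k)"

end

theory Submission
  imports Defs
begin

text \<open>
  In a 312-avoiding permutation the descents, and the positions at which a hook may end, are
  determined by the running maximum, and the hooks are recovered from the set of their NE endpoints
  by bracket matching. So a reduced configuration with \<open>k\<close> hooks is a word over the letters
  \<open>Top a\<close> (a left-to-right maximum that is no NE endpoint, with the descent bottom which follows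
  it), \<open>Bot\<close> (any other descent bottom) and \<open>NE a\<close> (an NE endpoint); here \<open>Suc a\<close> is the
  increase of the running maximum. The word is valid iff every prefix satisfies
  $\#\mathit{NE} \le \#\mathit{Top} + \#\mathit{Bot} \le \sum a$, with equality
  throughout (and value \<open>k\<close>) for the whole word.

  The permutation has length $2k + \#\mathit{Top}$, so the sign of a word is
  $(-1)^{\#\mathit{Bot}}$. Since \<open>Top 0\<close> and \<open>Bot\<close> have the same effect on validity, swapping
  the first occurrence of one of them for the other cancels all words containing such a letter.
  In the remaining words every \<open>Top a\<close> has \<open>a = 1\<close> and every \<open>NE a\<close> has \<open>a = 0\<close>: these are the
  Dyck words of length \<open>2k\<close>.
\<close>

section \<open>Signed words\<close>

datatype letter = Top nat | Bot | NE nat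

text \<open>
  The arguments \<open>x\<close> and \<open>y\<close> are the current slacks in the two inequalities of the validity condition.
\<close>

fun walk :: "nat \<Rightarrow> nat \<Rightarrow> letter list \<Rightarrow> bool" where
  "walk x y [] \<longleftrightarrow> x = 0 \<and> y = 0"
| "walk x y (Top a # w) \<longleftrightarrow> 1 \<le> x + a \<and> walk (x + a - 1) (Suc y) w"
| "walk x y (Bot # w) \<longleftrightarrow> 1 \<le> x \<and> walk (x - 1) (Suc y) w"
| "walk x y (NE a # w) \<longleftrightarrow> 1 \<le> y \<and> walk (x + a) (y - 1) w"

text \<open>A \<open>Top\<close> letter spans two positions: a record that is no NE endpoint, and
  the descent bottom that reducedness forces right after it. Hence words have fixed length
  \<open>2 * k\<close> while the permutation length varies.\<close>

fun steps_of :: "letter list \<Rightarrow> (nat \<times> bool) list" where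
  "steps_of [] = []"
| "steps_of (Top a # w) = (Suc a, False) # (0, False) # steps_of w"
| "steps_of (Bot # w) = (0, False) # steps_of w"
| "steps_of (NE a # w) = (Suc a, True) # steps_of w"

fun tops :: "letter list \<Rightarrow> nat" where
  "tops [] = 0"
| "tops (Top a # w) = Suc (tops w)"
| "tops (Bot # w) = tops w"
| "tops (NE a # w) = tops w"

fun bots :: "letter list \<Rightarrow> nat" where
  "bots [] = 0"
| "bots (Top a # w) = bots w"
| "bots (Bot # w) = Suc (bots w)"
| "bots (NE a # w) = bots w"

fun nes :: "letter list \<Rightarrow> nat" where
  "nes [] = 0"
| "nes (Top a # w) = nes w"
| "nes (Bot # w) = nes w"
| "nes (NE a # w) = Suc (nes w)"

fun flip :: "letter list \<Rightarrow> letter list" where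
  "flip [] = []"
| "flip (s # w) = (if s = Top 0 then Bot # w else if s = Bot then Top 0 # w else s # flip w)"

definition words :: "nat \<Rightarrow> letter list set" where
  "words k = {w. walk 0 0 w \<and> nes w = k}"

text \<open>\<open>y\<close> rises by one at each \<open>Top\<close> or \<open>Bot\<close>, falls by
  one at each \<open>NE\<close>, and must end at 0.\<close>

lemma walk_balance: "walk x y w \<Longrightarrow> y + tops w + bots w = nes w"
  by (induction x y w rule: walk.induct) auto

lemma length_word: "length w = tops w + bots w + nes w"
  by (induction w rule: tops.induct) auto

lemma length_steps_of: "length (steps_of w) = length w + tops w"
  by (induction w rule: tops.induct) auto

lemma inj_steps_of: "inj steps_of"
proof
  have "steps_of v = steps_of w \<Longrightarrow> v = w" for v w
  proof (induction v arbitrary: w rule: tops.induct)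
    case 1
    then show ?case by (cases w rule: tops.cases) auto
  next
    case (2 a v)
    then show ?case by (cases w rule: tops.cases) auto
  next
    case (3 v)
    then show ?case by (cases w rule: tops.cases) auto
  next
    case (4 a v)
    then show ?case by (cases w rule: tops.cases) auto
  qed
  then show "steps_of v = steps_of w \<Longrightarrow> v = w" for v w .
qed

section \<open>The sign-reversing involution on a finite set of words\<close>

lemma flip_flip: "flip (flip w) = w"
  by (induction w) auto

lemma walk_flip: "walk x y (flip w) = walk x y w"
  by (induction x y w rule: walk.induct) auto

lemma nes_flip: "nes (flip w) = nes w"
  by (induction w rule: nes.induct) auto

lemma set_flip: "Top 0 \<in> set (flip w) \<or> Bot \<in> set (flip w) \<longleftrightarrow> Top 0 \<in> set w \<or> Bot \<in> set w"
  by (induction w) auto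

lemma bots_flip:
  "Top 0 \<in> set w \<or> Bot \<in> set w \<Longrightarrow> (-1) ^ bots (flip w) = - ((-1) ^ bots w :: real)"
  by (induction w rule: bots.induct) auto

text \<open>Each letter lowers \<open>x\<close> by at most one, and \<open>x\<close> must reach
  0.\<close>

lemma walk_le_length: "walk x y w \<Longrightarrow> x \<le> length w"
  by (induction x y w rule: walk.induct) auto

text \<open>A large letter parameter creates slack that the remaining letters cannot use up.
  Together with the fixed length this makes \<open>words k\<close> finite.\<close>

lemma walk_letter_bound:
  "walk x y w \<Longrightarrow> Top a \<in> set w \<or> NE a \<in> set w \<Longrightarrow> a \<le> length w"
proof (induction x y w rule: walk.induct)
  case (2 x y b w)
  then show ?case using walk_le_length[of "x + b - 1" "Suc y" w] by auto
next
  case (4 x y b w)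
  then show ?case using walk_le_length[of "x + b" "y - 1" w] by auto
qed auto

lemma length_words: "w \<in> words k \<Longrightarrow> length w = 2 * k"
  using walk_balance[of 0 0 w] length_word[of w] by (simp add: words_def)

lemma finite_words: "finite (words k)"
proof (rule finite_subset)
  let ?A = "insert Bot (Top ` {..2 * k} \<union> NE ` {..2 * k})"
  show "words k \<subseteq> {w. set w \<subseteq> ?A \<and> length w = 2 * k}"
  proof
    fix w assume w: "w \<in> words k"
    then have "s \<in> ?A" if "s \<in> set w" for s
      using walk_letter_bound[of 0 0 w] length_words[OF w] that by (cases s) (auto simp: words_def)
    then show "w \<in> {w. set w \<subseteq> ?A \<and> length w = 2 * k}"
      using length_words[OF w] by blast
  qed
  show "finite {w. set w \<subseteq> ?A \<and> length w = 2 * k}"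
    by (rule finite_lists_length_eq) simp
qed

lemma sum_flip:
  "(\<Sum>w\<in>words k. (-1) ^ bots w :: real) = real (card {w \<in> words k. Top 0 \<notin> set w \<and> Bot \<notin> set w})"
    (is "?S = real (card ?F)")
proof -
  let ?G = "{w \<in> words k. Top 0 \<in> set w \<or> Bot \<in> set w}"
  have flip_mem: "flip w \<in> ?G" if "w \<in> ?G" for w
    using that set_flip[of w] by (simp add: words_def walk_flip nes_flip)
  have "(\<Sum>w\<in>?G. (-1) ^ bots w :: real) = (\<Sum>w\<in>?G. - ((-1) ^ bots w))"
  proof (rule sum.reindex_bij_witness[of _ flip flip])
    show "- ((-1) ^ bots (flip w)) = ((-1) ^ bots w :: real)" if "w \<in> ?G" for w
      using that bots_flip[of w] by simp
  qed (simp_all only: flip_flip flip_mem)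
  \<comment> \<open>The sum over \<open>?G\<close> equals its own negative.\<close>
  then have G: "(\<Sum>w\<in>?G. (-1) ^ bots w :: real) = 0"
    by (simp add: sum_negf)
  have 0: "bots w = 0" if "Bot \<notin> set w" for w
    using that by (induction w rule: bots.induct) auto
  have "?S = (\<Sum>w\<in>?G \<union> ?F. (-1) ^ bots w)"
    by (rule sum.cong) auto
  also have "\<dots> = (\<Sum>w\<in>?F. (-1) ^ bots w)"
    using finite_words[of k] by (subst sum.union_disjoint) (auto simp: G)
  also have "\<dots> = real (card ?F)"
    by (simp add: 0)
  finally show ?thesis .
qed

section \<open>Ballot words and the Catalan number\<close>

definition ballot_words :: "nat \<Rightarrow> nat \<Rightarrow> letter list set" where
  "ballot_words y m = {w. walk 0 y w \<and> length w = m \<and> set w \<subseteq> {Top 1, NE 0}}"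

text \<open>Without \<open>Top 0\<close> and \<open>Bot\<close> no letter lowers \<open>x\<close>.
  As \<open>x\<close> ends at 0, it is 0 throughout, and only the letters that keep it fixed can
  occur.\<close>

lemma walk_no_flip:
  "walk x y w \<Longrightarrow> Top 0 \<notin> set w \<Longrightarrow> Bot \<notin> set w \<Longrightarrow> x = 0 \<and> set w \<subseteq> {Top 1, NE 0}"
  by (induction x y w rule: walk.induct) auto

lemma fixed_words_eq: "{w \<in> words k. Top 0 \<notin> set w \<and> Bot \<notin> set w} = ballot_words 0 (2 * k)"
proof -
  have "w \<in> words k \<longleftrightarrow> walk 0 0 w \<and> length w = 2 * k" for w
    using walk_balance[of 0 0 w] length_word[of w] by (auto simp: words_def)
  moreover have "Top 0 \<notin> set w \<and> Bot \<notin> set w \<longleftrightarrow> set w \<subseteq> {Top 1, NE 0}" if "walk 0 0 w" for w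
  proof
    show "Top 0 \<notin> set w \<and> Bot \<notin> set w \<Longrightarrow> set w \<subseteq> {Top 1, NE 0}"
      using walk_no_flip[OF that] by blast
    show "set w \<subseteq> {Top 1, NE 0} \<Longrightarrow> Top 0 \<notin> set w \<and> Bot \<notin> set w"
      by (auto dest: subsetD)
  qed
  ultimately show ?thesis
    by (auto simp only: ballot_words_def)
qed

lemma card_ballot_words_0: "card (ballot_words y 0) = (if y = 0 then 1 else 0)"
proof -
  have "ballot_words y 0 = (if y = 0 then {[]} else {})"
    by (auto simp: ballot_words_def)
  then show ?thesis by simp
qed

lemma card_ballot_words_Suc:
  "card (ballot_words y (Suc m)) =
     card (ballot_words (Suc y) m) + (if y = 0 then 0 else card (ballot_words (y - 1) m))"
proof -
  have fin: "finite (ballot_words y m)" for y m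
    by (rule finite_subset[OF _ finite_lists_length_eq[of "{Top 1, NE 0}" m]])
       (auto simp: ballot_words_def)
  have eq: "ballot_words y (Suc m) =
      (#) (Top 1) ` ballot_words (Suc y) m \<union>
      (#) (NE 0) ` (if y = 0 then {} else ballot_words (y - 1) m)"
    by (auto simp: ballot_words_def length_Suc_conv image_iff)
  show ?thesis
    unfolding eq using fin by (subst card_Un_disjoint) (auto simp: card_image)
qed

lemma card_ballot_words_short: "m < y \<Longrightarrow> card (ballot_words y m) = 0"
proof (induction m arbitrary: y)
  case 0
  then show ?case by (simp add: card_ballot_words_0)
next
  case (Suc m)
  then show ?case by (simp add: card_ballot_words_Suc)
qed

text \<open>With \<open>Top 1\<close> as up step and \<open>NE 0\<close> as down step, these are
  nonnegative paths from height \<open>y\<close> to 0 with \<open>d\<close> up steps. The ballot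
  formula, a difference of two binomials, is stated additively to avoid truncated subtraction and
  follows by Pascal's rule.\<close>

lemma card_ballot_words:
  "card (ballot_words y (y + 2 * d)) + (if d = 0 then 0 else (y + 2 * d) choose (d - 1)) =
     (y + 2 * d) choose d"
proof (induction "y + 2 * d" arbitrary: y d)
  case 0
  then show ?case by (simp add: card_ballot_words_0)
next
  case (Suc m)
  have rec: "card (ballot_words y (Suc m)) =
      card (ballot_words (Suc y) m) + (if y = 0 then 0 else card (ballot_words (y - 1) m))"
    by (rule card_ballot_words_Suc)
  \<comment> \<open>A first down step leaves all \<open>d\<close> up steps to be made; a first up
    step, treated below, leaves \<open>d - 1\<close>.\<close>
  have down: "card (ballot_words (y - 1) m) + (if d = 0 then 0 else m choose (d - 1)) = m choose d"
    if "y > 0"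
  proof -
    have m: "m = y - 1 + 2 * d"
      using Suc.hyps(2) that by simp
    show ?thesis
      using Suc.hyps(1)[OF m] unfolding m[symmetric] .
  qed
  have "card (ballot_words y (Suc m)) + (if d = 0 then 0 else Suc m choose (d - 1)) = Suc m choose d"
  proof (cases d)
    case 0
    \<comment> \<open>All steps go down: after an up step the path would be too high to
      return.\<close>
    then have "y = Suc m" using Suc.hyps(2) by simp
    then show ?thesis
      using rec down 0 by (simp add: card_ballot_words_short)
  next
    case d: (Suc d')
    have m: "m = Suc y + 2 * d'" using Suc.hyps(2) d by simp
    have up: "card (ballot_words (Suc y) m) + (if d' = 0 then 0 else m choose (d' - 1)) = m choose d'"
      using Suc.hyps(1)[OF m] unfolding m[symmetric] .
    have pascal: "Suc m choose d' = (m choose d') + (if d' = 0 then 0 else m choose (d' - 1))"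
      by (cases d') auto
    have "Suc m choose d = (m choose d') + (m choose d)"
      using d by simp
    \<comment> \<open>At height 0 the down step is missing. Here \<open>m = d' + d\<close>, so by
      symmetry the difference that it would contribute is zero.\<close>
    moreover have "m choose d' = m choose d" if "y = 0"
      using binomial_symmetric[of d' m] m d that by simp
    moreover have "card (ballot_words (y - 1) m) + (m choose d') = m choose d" if "y > 0"
      using down[OF that] d by simp
    moreover have "(if d = 0 then 0 else Suc m choose (d - 1)) = Suc m choose d'"
      using d by simp
    moreover have "card (ballot_words y (Suc m)) = card (ballot_words (Suc y) m)" if "y = 0"
      using rec that by simp
    moreover have "card (ballot_words y (Suc m)) =
        card (ballot_words (Suc y) m) + card (ballot_words (y - 1) m)" if "y > 0"
      using rec that by simp
    ultimately show ?thesis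
      using up pascal by (cases "y > 0") linarith+
  qed
  then show ?case
    unfolding Suc.hyps(2) .
qed

lemma card_ballot_words_catalan: "real (card (ballot_words 0 (2 * k))) = catalan_number k"
proof (cases k)
  case 0
  then show ?thesis by (simp add: card_ballot_words_0 catalan_number_def)
next
  case (Suc j)
  let ?c = "real (card (ballot_words 0 (2 * k)))" and ?b = "real (2 * k choose k)"
  have c: "real (2 * k choose j) = ?b - ?c"
    using card_ballot_words[of 0 k] Suc by (simp flip: of_nat_add)
  \<comment> \<open>Since \<open>k = Suc j\<close>, the factor \<open>2 * k - j\<close> is
    \<open>k + 1\<close>; this expresses both binomials of the ballot formula through one.\<close>
  have "Suc j * (2 * k choose Suc j) = (2 * k - j) * (2 * k choose j)"
    using binomial_absorption[of j "2 * k"] binomial_absorb_comp[of "2 * k" j] by simp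
  then have "real k * ?b = (real k + 1) * real (2 * k choose j)"
    using Suc by (simp flip: of_nat_mult of_nat_Suc add: algebra_simps)
  then have "(real k + 1) * ?c = ?b"
    unfolding c by (simp add: algebra_simps)
  then show ?thesis
    by (simp add: catalan_number_def field_simps)
qed

section \<open>Step lists: the words read position by position\<close>

text \<open>
  A step list records for every position of a permutation the increase of the running maximum and
  whether the position carries an NE endpoint.
\<close>

definition zeros :: "(nat \<times> bool) list \<Rightarrow> nat" where
  "zeros e = length (filter (\<lambda>s. fst s = 0) e)"

definition marks :: "(nat \<times> bool) list \<Rightarrow> nat" where
  "marks e = length (filter snd e)"

definition height :: "(nat \<times> bool) list \<Rightarrow> nat" where
  "height e = sum_list (map fst e)"

text \<open>For \<open>x = y = 0\<close>: the first \<open>m\<close> entries have maximum at least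
  \<open>m\<close>, as distinct positive numbers must, and NE endpoints never outnumber descent
  bottoms. The offsets \<open>x\<close> and \<open>y\<close> allow a recursion on the list.\<close>

definition adm :: "nat \<Rightarrow> nat \<Rightarrow> (nat \<times> bool) list \<Rightarrow> bool" where
  "adm x y e \<longleftrightarrow>
     (\<forall>m\<le>length e. m \<le> x + height (take m e) \<and> marks (take m e) \<le> y + zeros (take m e)) \<and>
     x + height e = length e \<and> marks e = y + zeros e"

text \<open>NE endpoints sit at records, and a record that is no NE endpoint must be a descent top,
  that is, be followed by a step without increase.\<close>

definition reduced_steps :: "(nat \<times> bool) list \<Rightarrow> bool" where
  "reduced_steps e \<longleftrightarrow>
     (\<forall>i<length e. (snd (e ! i) \<longrightarrow> 0 < fst (e ! i)) \<and>
        (\<not> snd (e ! i) \<and> 0 < fst (e ! i) \<longrightarrow> Suc i < length e \<and> fst (e ! Suc i) = 0))"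

lemma All_le_Suc: "(\<forall>m\<le>Suc n. P m) \<longleftrightarrow> P 0 \<and> (\<forall>m\<le>n. P (Suc m))"
  by (metis Suc_le_mono le0 not0_implies_Suc)

lemma adm_Nil: "adm x y [] \<longleftrightarrow> x = 0 \<and> y = 0"
  by (auto simp: adm_def zeros_def marks_def height_def)

lemma adm_Cons:
  "adm x y ((d, t) # e) \<longleftrightarrow>
     1 \<le> x + d \<and> of_bool t \<le> y + of_bool (d = 0) \<and>
     adm (x + d - 1) (y + of_bool (d = 0) - of_bool t) e"
proof (cases "1 \<le> x + d \<and> of_bool t \<le> y + of_bool (d = 0)")
  case True
  \<comment> \<open>Under the case assumption the subtractions in the recursive call do not
    truncate.\<close>
  then have 1: "Suc m \<le> x + (d + h) \<longleftrightarrow> m \<le> x + d - 1 + h"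
    "x + (d + h) = Suc m \<longleftrightarrow> x + d - 1 + h = m"
    "of_bool t + a \<le> y + (of_bool (d = 0) + b) \<longleftrightarrow> a \<le> y + of_bool (d = 0) - of_bool t + b"
    "of_bool t + a = y + (of_bool (d = 0) + b) \<longleftrightarrow> a = y + of_bool (d = 0) - of_bool t + b"
    for m h a b
    by linarith+
  have "height ((d, t) # e') = d + height e'" "zeros ((d, t) # e') = of_bool (d = 0) + zeros e'"
    "marks ((d, t) # e') = of_bool t + marks e'" for e'
    by (simp_all add: height_def zeros_def marks_def)
  then show ?thesis
    using True by (simp add: adm_def All_le_Suc 1) (simp add: height_def zeros_def marks_def)
next
  case False
  have "1 \<le> x + d \<and> of_bool t \<le> y + of_bool (d = 0)" if "adm x y ((d, t) # e)"
  proof -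
    \<comment> \<open>The prefix of length 1 already gives the two conditions on the head.\<close>
    have "(1::nat) \<le> length ((d, t) # e)" by simp
    then have "1 \<le> x + height (take 1 ((d, t) # e)) \<and> marks (take 1 ((d, t) # e)) \<le> y + zeros (take 1 ((d, t) # e))"
      using that unfolding adm_def by blast
    then show ?thesis
      by (cases t) (auto simp: height_def zeros_def marks_def split: if_splits)
  qed
  then show ?thesis using False by blast
qed

text \<open>The two steps of \<open>Top a\<close> change \<open>x\<close> by \<open>a\<close> and
  then by \<open>-1\<close>, and the second raises \<open>y\<close>; together this is the
  \<open>Top\<close> clause of \<open>walk\<close>.\<close>

lemma adm_steps_of: "adm x y (steps_of w) \<longleftrightarrow> walk x y w"
  by (induction x y w rule: walk.induct) (simp_all add: adm_Nil adm_Cons)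

lemma marks_steps_of: "marks (steps_of w) = nes w"
  by (induction w rule: nes.induct) (simp_all add: marks_def)

lemma reduced_steps_Nil: "reduced_steps []"
  by (simp add: reduced_steps_def)

lemma reduced_steps_Cons:
  "reduced_steps (s # e) \<longleftrightarrow>
     (snd s \<longrightarrow> 0 < fst s) \<and> (\<not> snd s \<and> 0 < fst s \<longrightarrow> e \<noteq> [] \<and> fst (hd e) = 0) \<and>
     reduced_steps e"
  by (cases e) (simp_all add: reduced_steps_def All_less_Suc2 conj_ac)

lemma reduced_steps_of: "reduced_steps (steps_of w)"
  by (induction w rule: nes.induct) (simp_all add: reduced_steps_Nil reduced_steps_Cons)

text \<open>The list is parsed from the left: a marked step is an \<open>NE\<close>, an unmarked
  zero a \<open>Bot\<close>, and an unmarked increase together with the zero after it a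
  \<open>Top\<close>. Since the last case consumes two steps, the induction is on length.\<close>

lemma reduced_steps_in_range: "reduced_steps e \<Longrightarrow> e \<in> range steps_of"
proof (induction e rule: length_induct)
  case (1 e)
  show ?case
  proof (cases e)
    case Nil
    then show ?thesis by (metis rangeI steps_of.simps(1))
  next
    case (Cons s e')
    obtain d t where s: "s = (d, t)" by (cases s)
    from Cons 1 have red: "reduced_steps e'" by (simp add: reduced_steps_Cons)
    then have "e' \<in> range steps_of" using "1.IH" Cons by simp
    then obtain w where w: "e' = steps_of w" by blast
    consider "t" | "\<not> t" "d = 0" | "\<not> t" "d > 0" by blast
    then show ?thesis
    proof cases
      case 1
      then have "e = steps_of (NE (d - 1) # w)"
        using Cons s w \<open>reduced_steps e\<close> by (simp add: reduced_steps_Cons)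
      then show ?thesis by blast
    next
      case 2
      then have "e = steps_of (Bot # w)"
        using Cons s w by simp
      then show ?thesis by blast
    next
      case 3
      then obtain u e'' where e': "e' = (0, u) # e''"
        using Cons s \<open>reduced_steps e\<close> by (cases e') (auto simp: reduced_steps_Cons)
      \<comment> \<open>A marked step would have a positive increase, so the zero step is
        unmarked.\<close>
      then have "reduced_steps e''" and u: "\<not> u"
        using red by (auto simp: reduced_steps_Cons)
      then have "e'' \<in> range steps_of" using "1.IH" Cons e' by simp
      then obtain v where "e'' = steps_of v" by blast
      then have "e = steps_of (Top (d - 1) # v)"
        using 3 Cons s e' u by simp
      then show ?thesis by blast
    qed
  qed
qed

definition step_lists :: "nat \<Rightarrow> nat \<Rightarrow> (nat \<times> bool) list set" where
  "step_lists n k = {e. length e = n \<and> adm 0 0 e \<and> marks e = k \<and> reduced_steps e}"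

lemma card_step_lists: "card (step_lists n k) = card {w \<in> words k. 2 * k + tops w = n}"
proof -
  have "step_lists n k = steps_of ` {w \<in> words k. 2 * k + tops w = n}"
  proof (intro equalityI subsetI)
    fix e assume e: "e \<in> step_lists n k"
    then obtain w where w: "e = steps_of w"
      using reduced_steps_in_range by (auto simp: step_lists_def)
    with e have k: "w \<in> words k"
      by (simp add: words_def step_lists_def adm_steps_of marks_steps_of)
    with e w have "2 * k + tops w = n"
      using length_words[OF k] by (simp add: step_lists_def length_steps_of)
    then show "e \<in> steps_of ` {w \<in> words k. 2 * k + tops w = n}"
      using k w by blast
  next
    fix e assume "e \<in> steps_of ` {w \<in> words k. 2 * k + tops w = n}"
    then obtain w where w: "e = steps_of w" "w \<in> words k" "2 * k + tops w = n" by blast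
    then show "e \<in> step_lists n k"
      using length_words[OF w(2)] reduced_steps_of[of w]
      by (simp add: words_def step_lists_def adm_steps_of marks_steps_of length_steps_of)
  qed
  then show ?thesis
    by (simp add: card_image inj_on_subset[OF inj_steps_of])
qed

lemma alternating_sum_words:
  assumes "k \<ge> 1"
  shows "(\<Sum>i=0..k-1. (-1) ^ i * real (card {w \<in> words k. 2 * k + tops w = 3 * k - i})) =
    catalan_number k"
proof -
  have bal: "tops w + bots w = k" if "w \<in> words k" for w
    using that walk_balance[of 0 0 w] by (simp add: words_def)
  \<comment> \<open>With both slacks 0 the first letter must be a \<open>Top\<close>. Hence the
    range of \<open>i\<close> in the sum covers all words.\<close>
  have bots: "bots w \<le> k - 1" if w: "w \<in> words k" for w
  proof -
    have "w \<noteq> []" "walk 0 0 w"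
      using w assms by (auto simp: words_def)
    then have "tops w \<noteq> 0" by (cases w rule: tops.cases) auto
    then show ?thesis using bal[OF w] by simp
  qed
  have "(\<Sum>i=0..k-1. (-1) ^ i * real (card {w \<in> words k. 2 * k + tops w = 3 * k - i})) =
      (\<Sum>i=0..k-1. \<Sum>w | w \<in> words k \<and> bots w = i. (-1) ^ bots w)"
  proof (rule sum.cong[OF refl])
    fix i assume "i \<in> {0..k-1}"
    \<comment> \<open>The summation index counts the \<open>Bot\<close> letters, because
      \<open>tops w = k - bots w\<close>.\<close>
    then have "{w \<in> words k. 2 * k + tops w = 3 * k - i} = {w \<in> words k. bots w = i}"
      using bal assms by force
    then show "(-1) ^ i * real (card {w \<in> words k. 2 * k + tops w = 3 * k - i}) =
        (\<Sum>w | w \<in> words k \<and> bots w = i. (-1) ^ bots w)"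
      by (simp add: mult.commute)
  qed
  also have "\<dots> = (\<Sum>w\<in>words k. (-1) ^ bots w)"
    using bots finite_words by (intro sum.group) auto
  also have "\<dots> = catalan_number k"
    by (simp add: sum_flip fixed_words_eq card_ballot_words_catalan)
  finally show ?thesis .
qed

section \<open>Noncrossing matchings\<close>

text \<open>The bounds on \<open>i'\<close> are strict because the NE endpoint of one hook may be
  the SW endpoint of another.\<close>

definition noncrossing_matching :: "(nat \<times> nat) set \<Rightarrow> bool" where
  "noncrossing_matching H \<longleftrightarrow> inj_on fst H \<and> inj_on snd H \<and> (\<forall>(i, j)\<in>H. i < j) \<and>
     (\<forall>(i, j)\<in>H. \<forall>(i', j')\<in>H. i < i' \<and> i' < j \<longrightarrow> j' < j)"

text \<open>Bracket matching: the smallest right end is joined to the largest left end before it,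
  and both are removed.\<close>

lemma noncrossing_matching_exists:
  fixes D T :: "nat set"
  assumes "finite D" "finite T" "card D = card T"
    and "\<And>j. j \<in> T \<Longrightarrow> card {t \<in> T. t \<le> j} \<le> card {i \<in> D. i < j}"
  shows "\<exists>H. noncrossing_matching H \<and> fst ` H = D \<and> snd ` H = T"
  using assms
proof (induction "card T" arbitrary: D T)
  case 0
  then show ?case by (intro exI[of _ "{}"]) (auto simp: noncrossing_matching_def)
next
  case (Suc c)
  define j where "j = Min T"
  have T: "T \<noteq> {}" "finite T" using Suc by auto
  have jT: "j \<in> T" and jmin: "\<And>t. t \<in> T \<Longrightarrow> j \<le> t"
    using T by (auto simp: j_def)
  have "{t \<in> T. t \<le> j} = {j}" using jT jmin by (auto intro: antisym)
  then have "0 < card {i \<in> D. i < j}" using Suc.prems(4)[OF jT] by simp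
  then have ne: "{i \<in> D. i < j} \<noteq> {}" by (auto simp: card_gt_0_iff)
  define i where "i = Max {i \<in> D. i < j}"
  have fin: "finite {i \<in> D. i < j}" using Suc.prems(1) by simp
  have iD: "i \<in> D" "i < j" and imax: "\<And>d. d \<in> D \<Longrightarrow> d < j \<Longrightarrow> d \<le> i"
    using Max_in[OF fin ne] Max_ge[OF fin] by (auto simp: i_def)
  have "\<exists>H. noncrossing_matching H \<and> fst ` H = D - {i} \<and> snd ` H = T - {j}"
  proof (rule Suc.hyps(1)[of "T - {j}" "D - {i}"])
    show "c = card (T - {j})" using Suc.hyps(2) jT by simp
    show "finite (D - {i})" "finite (T - {j})" using Suc.prems by auto
    show "card (D - {i}) = card (T - {j})" using Suc.prems jT iD by simp
    fix l assume l: "l \<in> T - {j}"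
    then have jl: "j < l" using jmin[of l] by auto
    \<comment> \<open>Beyond \<open>j\<close> both counts drop by exactly one, so the ballot
      condition survives.\<close>
    have "{t \<in> T - {j}. t \<le> l} = {t \<in> T. t \<le> l} - {j}" by auto
    moreover have "{d \<in> D - {i}. d < l} = {d \<in> D. d < l} - {i}" by auto
    ultimately show "card {t \<in> T - {j}. t \<le> l} \<le> card {d \<in> D - {i}. d < l}"
      using Suc.prems(4)[of l] l jT jl iD by simp
  qed
  then obtain H where H: "fst ` H = D - {i}" "snd ` H = T - {j}" "inj_on fst H" "inj_on snd H"
    "\<forall>(i, j)\<in>H. i < j" "\<forall>(i, j)\<in>H. \<forall>(i', j')\<in>H. i < i' \<and> i' < j \<longrightarrow> j' < j"
    unfolding noncrossing_matching_def by (elim exE conjE) (rule that)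
  have HD: "a \<in> D" "a \<noteq> i" "b \<in> T" "j < b" if "(a, b) \<in> H" for a b
  proof -
    have "a \<in> fst ` H" "b \<in> snd ` H"
      using that by (auto intro: rev_image_eqI)
    then have "a \<in> D - {i}" "b \<in> T - {j}"
      unfolding H(1,2) .
    then show "a \<in> D" "a \<noteq> i" "b \<in> T" "j < b" using jmin[of b] by auto
  qed
  show ?case
    unfolding noncrossing_matching_def
  proof (intro exI[of _ "insert (i, j) H"] conjI)
    show "fst ` insert (i, j) H = D" using H(1) iD by auto
    show "snd ` insert (i, j) H = T" using H(2) jT by auto
    show "inj_on fst (insert (i, j) H)" using H(1,3) by auto
    show "inj_on snd (insert (i, j) H)" using H(2,4) by auto
    show "\<forall>(i, j)\<in>insert (i, j) H. i < j" using H(5) iD by auto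
    show "\<forall>(a, b)\<in>insert (i, j) H. \<forall>(a', b')\<in>insert (i, j) H. a < a' \<and> a' < b \<longrightarrow> b' < b"
    proof (clarify, goal_cases)
      case (1 a b a' b')
      show ?case
      \<comment> \<open>No other left end lies between \<open>i\<close> and \<open>j\<close> by
        maximality of \<open>i\<close>, and every other right end exceeds \<open>j\<close>.\<close>
      proof (cases "(a, b) = (i, j)")
        case True
        then show ?thesis using 1 HD[of a' b'] imax[of a'] by auto
      next
        case False
        then have ab: "(a, b) \<in> H" using 1 by auto
        show ?thesis
        proof (cases "(a', b') = (i, j)")
          case True
          then show ?thesis using HD(4)[OF ab] by simp
        next
          case False
          then have "(a', b') \<in> H" using 1 by auto
          then show ?thesis using ab H(6) 1 by blast
        qed
      qed
    qed
  qed
qed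

text \<open>The greedy choice is forced: the smallest right end can only belong to the largest left
  end before it.\<close>

lemma noncrossing_matching_unique:
  fixes H H' :: "(nat \<times> nat) set"
  assumes "finite H"
    and "fst ` H = fst ` H'" "snd ` H = snd ` H'"
    and "noncrossing_matching H" "noncrossing_matching H'"
  shows "H = H'"
  using assms
proof (induction "card H" arbitrary: H H')
  case 0
  then show ?case by auto
next
  case (Suc c)
  define T where "T = snd ` H"
  define D where "D = fst ` H"
  have T: "T \<noteq> {}" "finite T"
    using Suc.hyps(2) Suc.prems(1) by (auto simp: T_def)
  define j where "j = Min T"
  have jT: "j \<in> T" and jmin: "\<And>t. t \<in> T \<Longrightarrow> j \<le> t"
    using T by (auto simp: j_def)
  have source: "(Max {i \<in> fst ` K. i < j}, j) \<in> K"
    if "fst ` K = D" "snd ` K = T" "noncrossing_matching K" for K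
  proof -
    have K: "fst ` K = D" "snd ` K = T" "\<forall>(i, j)\<in>K. i < j"
      "\<forall>(i, j)\<in>K. \<forall>(i', j')\<in>K. i < i' \<and> i' < j \<longrightarrow> j' < j"
      using that by (auto simp only: noncrossing_matching_def)
    obtain i where i: "(i, j) \<in> K" using jT K(2) by force
    have "Max {i \<in> fst ` K. i < j} = i"
    proof (rule Max_eqI)
      show "finite {i \<in> fst ` K. i < j}" using K(1) Suc.prems(1) by (simp add: D_def)
      show "i \<in> {i \<in> fst ` K. i < j}" using i K(3) by force
      fix d assume "d \<in> {i \<in> fst ` K. i < j}"
      then obtain b where b: "(d, b) \<in> K" "d < j" by auto
      have "b \<in> T" using b K(2) by force
      then have "\<not> b < j" using jmin[of b] by simp
      \<comment> \<open>A left end strictly between \<open>i\<close> and \<open>j\<close> would have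
        its partner before \<open>j\<close>, against minimality of \<open>j\<close>.\<close>
      then show "d \<le> i" using K(4) i b by force
    qed
    then show ?thesis using i by simp
  qed
  define i where "i = Max {i \<in> D. i < j}"
  have i: "(i, j) \<in> H" "(i, j) \<in> H'"
    using source[of H] source[of H'] Suc.prems by (simp_all add: i_def D_def T_def)
  have "H - {(i, j)} = H' - {(i, j)}"
  proof (rule Suc.hyps(1))
    show "c = card (H - {(i, j)})" using Suc.hyps(2) i by simp
    have *: "f ` (K - {p}) = f ` K - {f p}" if "inj_on f K" "p \<in> K" for f :: "nat \<times> nat \<Rightarrow> nat" and K p
      using that by (auto simp: inj_on_def)
    show "fst ` (H - {(i, j)}) = fst ` (H' - {(i, j)})"
      using *[of fst H] *[of fst H'] i Suc.prems by (simp add: noncrossing_matching_def)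
    show "snd ` (H - {(i, j)}) = snd ` (H' - {(i, j)})"
      using *[of snd H] *[of snd H'] i Suc.prems by (simp add: noncrossing_matching_def)
    have sub: "noncrossing_matching (K - {p})" if "noncrossing_matching K" for K p
      using that unfolding noncrossing_matching_def by (blast intro: inj_on_diff)
    show "noncrossing_matching (H - {(i, j)})" "noncrossing_matching (H' - {(i, j)})"
      using sub Suc.prems by auto
    show "finite (H - {(i, j)})" using Suc.prems by simp
  qed
  then show ?case using i by blast
qed

text \<open>Each right end before \<open>m\<close> has its own left end \<open>i\<close>, with
  \<open>Suc i\<close> at most that right end. For hooks \<open>Suc i\<close> is the descent
  bottom.\<close>

lemma noncrossing_matching_ballot:
  fixes H :: "(nat \<times> nat) set"
  assumes "finite H" "noncrossing_matching H"
  shows "card {t \<in> snd ` H. t < m} \<le> card {i \<in> fst ` H. Suc i < m}"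
proof -
  let ?K = "{p \<in> H. snd p < m}"
  have H: "inj_on fst H" "inj_on snd H" "\<forall>(i, j)\<in>H. i < j"
    using assms(2) by (auto simp only: noncrossing_matching_def)
  have "{t \<in> snd ` H. t < m} = snd ` ?K" by auto
  then have "card {t \<in> snd ` H. t < m} = card ?K"
    using H(2) by (simp add: card_image inj_on_subset[of _ H])
  also have "\<dots> = card (fst ` ?K)"
    using H(1) by (subst card_image) (auto intro: inj_on_subset[of _ H])
  also have "\<dots> \<le> card {i \<in> fst ` H. Suc i < m}"
    using assms(1) H(3) by (intro card_mono) force+
  finally show ?thesis .
qed

section \<open>Running maxima of 312-avoiding permutations\<close>

text \<open>The inserted 0 covers the empty prefix and lies below all entries of a
  permutation.\<close>

definition prefix_max :: "nat list \<Rightarrow> nat \<Rightarrow> nat" where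
  "prefix_max xs i = Max (insert 0 (set (take i xs)))"

lemma prefix_max_0 [simp]: "prefix_max xs 0 = 0"
  by (simp add: prefix_max_def)

lemma prefix_max_Suc: "i < length xs \<Longrightarrow> prefix_max xs (Suc i) = max (prefix_max xs i) (xs ! i)"
proof -
  assume "i < length xs"
  then have "insert 0 (set (take (Suc i) xs)) = insert (xs ! i) (insert 0 (set (take i xs)))"
    by (auto simp: take_Suc_conv_app_nth)
  then show ?thesis
    unfolding prefix_max_def by (subst max.commute) simp
qed

lemma prefix_max_ge: "j < i \<Longrightarrow> j < length xs \<Longrightarrow> xs ! j \<le> prefix_max xs i"
  unfolding prefix_max_def by (rule Max_ge) (auto simp: in_set_conv_nth)

lemma le_prefix_max_length: "x \<in> set xs \<Longrightarrow> x \<le> prefix_max xs (length xs)"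
  by (simp add: prefix_max_def)

lemma prefix_max_attained:
  assumes "0 < prefix_max xs i"
  obtains j where "j < i" "j < length xs" "xs ! j = prefix_max xs i"
proof -
  have "prefix_max xs i \<in> insert 0 (set (take i xs))"
    unfolding prefix_max_def by (rule Max_in) auto
  then have "prefix_max xs i \<in> set (take i xs)" using assms by simp
  then show thesis using that by (auto simp: in_set_conv_nth)
qed

lemma prefix_max_append: "i \<le> length xs \<Longrightarrow> prefix_max (xs @ ys) i = prefix_max xs i"
  by (simp add: prefix_max_def)

lemma Av312D:
  assumes "xs \<in> Av312 n"
  shows "length xs = n" "distinct xs" "set xs = {1..n}" "avoids_312 xs"
  using assms permutations_of_setD[of xs "{1..n}"] length_finite_permutations_of_set[of xs "{1..n}"]
  by (auto simp: Av312_def)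

lemma length_le_prefix_max:
  assumes "xs \<in> Av312 n" "i \<le> n"
  shows "i \<le> prefix_max xs i"
proof -
  note xs = Av312D[OF assms(1)]
  have "set (take i xs) \<subseteq> {1..prefix_max xs i}"
    using xs(3) set_take_subset[of i xs] by (auto simp: prefix_max_def)
  then have "card (set (take i xs)) \<le> prefix_max xs i"
    using card_mono[of "{1..prefix_max xs i}"] by simp
  then show ?thesis
    using xs assms(2) by (simp add: distinct_card)
qed

lemma prefix_max_full: "xs \<in> Av312 n \<Longrightarrow> prefix_max xs n = n"
proof (rule antisym)
  assume xs: "xs \<in> Av312 n"
  show "prefix_max xs n \<le> n"
    using Av312D[OF xs] by (auto simp: prefix_max_def)
  show "n \<le> prefix_max xs n"
    using length_le_prefix_max[OF xs] by simp
qed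

text \<open>An ascent whose upper entry stays below the running maximum would form a 312 pattern
  with the earlier entry attaining that maximum.\<close>

lemma descent_iff_prefix_max:
  assumes "xs \<in> Av312 n" "Suc i < n"
  shows "i \<in> descents xs \<longleftrightarrow> prefix_max xs (Suc (Suc i)) = prefix_max xs (Suc i)"
proof
  note xs = Av312D[OF assms(1)]
  have rec: "prefix_max xs (Suc (Suc i)) = max (prefix_max xs (Suc i)) (xs ! Suc i)"
    using assms(2) xs(1) by (simp add: prefix_max_Suc)
  {
    assume "i \<in> descents xs"
    then have "xs ! Suc i < xs ! i" by (simp add: descents_def)
    also have "\<dots> \<le> prefix_max xs (Suc i)"
      using assms(2) xs(1) by (intro prefix_max_ge) auto
    finally show "prefix_max xs (Suc (Suc i)) = prefix_max xs (Suc i)"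
      using rec by simp
  }
  assume eq: "prefix_max xs (Suc (Suc i)) = prefix_max xs (Suc i)"
  show "i \<in> descents xs"
  proof (rule ccontr)
    assume "i \<notin> descents xs"
    then have "xs ! i \<le> xs ! Suc i" using assms(2) xs(1) by (auto simp: descents_def)
    moreover have "xs ! i \<noteq> xs ! Suc i"
      using assms(2) xs(1,2) by (simp add: nth_eq_iff_index_eq)
    ultimately have less: "xs ! i < xs ! Suc i" by simp
    have "xs ! Suc i \<le> prefix_max xs (Suc i)" using rec eq by simp
    then obtain a where a: "a < Suc i" "a < length xs" "xs ! a = prefix_max xs (Suc i)"
      using less prefix_max_attained[of xs "Suc i"] by auto
    have "xs ! a \<noteq> xs ! Suc i"
      using assms(2) xs(1,2) a(1,2) nth_eq_iff_index_eq[of xs a "Suc i"] by simp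
    then have "xs ! Suc i < xs ! a" using a rec eq by simp
    moreover from this less a have "a < i" by (metis less_SucE not_less_iff_gr_or_eq)
    ultimately show False
      using xs(1,4) less assms(2) unfolding avoids_312_def
      by (metis lessI)
  qed
qed

text \<open>
  In a 312-avoiding permutation an entry below the running maximum is the largest value below that
  maximum which has not been used yet.
\<close>

lemma Av312_eq_if_prefix_max_eq:
  assumes "xs \<in> Av312 n" "ys \<in> Av312 n" "\<And>i. i \<le> n \<Longrightarrow> prefix_max xs i = prefix_max ys i"
  shows "xs = ys"
proof -
  \<comment> \<open>At a first difference with the smaller entry in \<open>xs\<close>, the value
    \<open>ys ! i\<close> is still to come in \<open>xs\<close>, at some \<open>c\<close>. It lies
    below the running maximum, attained at some \<open>a\<close>, so \<open>a < i < c\<close> form a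
    312 pattern.\<close>
  have not_less: "\<not> xs ! i < ys ! i"
    if "xs \<in> Av312 n" "ys \<in> Av312 n" "i < n" "take i xs = take i ys"
      "prefix_max xs (Suc i) = prefix_max ys (Suc i)" for xs ys i
  proof
    assume less: "xs ! i < ys ! i"
    note xs = Av312D[OF that(1)] and ys = Av312D[OF that(2)]
    have "ys ! i \<in> set xs"
      using that(3) ys xs by (metis nth_mem)
    then obtain c where c: "c < n" "xs ! c = ys ! i"
      using xs(1) by (metis in_set_conv_nth)
    have neq: "ys ! i \<noteq> xs ! j" if "j < i" for j
    proof -
      have "xs ! j = ys ! j" using that \<open>take i xs = take i ys\<close> by (metis nth_take)
      then show ?thesis using that \<open>i < n\<close> ys by (simp add: nth_eq_iff_index_eq)
    qed
    have "i < c"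
      using neq[of c] c less by (metis linorder_neqE_nat not_less_iff_gr_or_eq)
    have le: "ys ! i \<le> prefix_max xs (Suc i)"
      using that(3,5) ys(1) prefix_max_ge[of i "Suc i" ys] by simp
    then obtain a where a: "a < Suc i" "a < length xs" "xs ! a = prefix_max xs (Suc i)"
      using less prefix_max_attained[of xs "Suc i"] by auto
    have "a \<noteq> i" using a le less by auto
    then have "a < i" using a by simp
    moreover have "ys ! i < xs ! a"
      using le a neq[OF \<open>a < i\<close>] by simp
    ultimately show False
      using xs(1,4) c less \<open>i < c\<close> unfolding avoids_312_def by metis
  qed
  have len: "length xs = n" "length ys = n"
    using assms Av312D by auto
  have "take i xs = take i ys" if "i \<le> n" for i
    using that
  proof (induction i)
    case (Suc i)
    then have "\<not> xs ! i < ys ! i" "\<not> ys ! i < xs ! i"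
      using assms not_less[of xs ys i] not_less[of ys xs i] by simp_all
    then have "xs ! i = ys ! i" by simp
    then show ?case
      using Suc len by (simp add: take_Suc_conv_app_nth)
  qed simp
  from this[of n] show ?thesis using len by simp
qed

text \<open>
  The last conjunct is the form of 312-avoidance that survives extension: every value between a
  later and an earlier larger entry has occurred already.
\<close>

lemma list_with_prefix_max:
  fixes m :: "nat \<Rightarrow> nat"
  assumes "m 0 = 0" "\<And>i. i < n \<Longrightarrow> m i \<le> m (Suc i)" "\<And>i. i \<le> n \<Longrightarrow> i \<le> m i"
  shows "\<exists>xs. length xs = n \<and> distinct xs \<and> 0 \<notin> set xs \<and> (\<forall>j\<le>n. prefix_max xs j = m j) \<and>
    (\<forall>a b v. a < b \<longrightarrow> b < n \<longrightarrow> xs ! b < v \<longrightarrow> v < xs ! a \<longrightarrow> v \<in> set (take b xs))"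
  using assms(2,3)
proof (induction n)
  case 0
  then show ?case using assms(1) by simp
next
  case (Suc n)
  then obtain xs where xs: "length xs = n" "distinct xs" "0 \<notin> set xs"
    "\<And>j. j \<le> n \<Longrightarrow> prefix_max xs j = m j"
    "\<And>a b v. a < b \<Longrightarrow> b < n \<Longrightarrow> xs ! b < v \<Longrightarrow> v < xs ! a \<Longrightarrow> v \<in> set (take b xs)"
    by (metis less_Suc_eq le_Suc_eq)
  have bound: "x \<le> m n" if "x \<in> set xs" for x
    using le_prefix_max_length[OF that] xs(1) xs(4)[of n] by simp
  have "\<exists>x. x \<noteq> 0 \<and> x \<notin> set xs \<and> max (m n) x = m (Suc n) \<and>
      (\<forall>v. x < v \<longrightarrow> v < m n \<longrightarrow> v \<in> set xs)"
  proof (cases "m n < m (Suc n)")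
    case True
    then have "m (Suc n) \<notin> set xs" using bound[of "m (Suc n)"] by auto
    then show ?thesis using True by (intro exI[of _ "m (Suc n)"]) auto
  next
    case False
    then have eq: "m (Suc n) = m n" using Suc.prems(1)[of n] by simp
    let ?U = "{1..m n} - set xs"
    \<comment> \<open>Here \<open>m n = m (Suc n)\<close> is at least \<open>Suc n\<close>, while
      only \<open>n\<close> values are used.\<close>
    have "card (set xs) < card {1..m n}"
      using Suc.prems(2)[of "Suc n"] eq xs(1,2) by (simp add: distinct_card)
    then have "?U \<noteq> {}"
      by (metis List.finite_set card_mono Diff_eq_empty_iff not_le)
    then have "Max ?U \<in> ?U" by (intro Max_in) auto
    moreover have "v \<in> set xs" if "Max ?U < v" "v < m n" for v
    proof (rule ccontr)
      assume "v \<notin> set xs"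
      then have "v \<le> Max ?U" using that by (intro Max_ge) auto
      then show False using that by simp
    qed
    ultimately show ?thesis using eq by (intro exI[of _ "Max ?U"]) auto
  qed
  then obtain x where x: "x \<noteq> 0" "x \<notin> set xs" "max (m n) x = m (Suc n)"
    "\<And>v. x < v \<Longrightarrow> v < m n \<Longrightarrow> v \<in> set xs"
    by blast
  show ?case
  proof (intro exI[of _ "xs @ [x]"] conjI allI impI)
    show "length (xs @ [x]) = Suc n" "distinct (xs @ [x])" "0 \<notin> set (xs @ [x])"
      using xs x by auto
    fix j assume "j \<le> Suc n"
    then show "prefix_max (xs @ [x]) j = m j"
      using xs(1,4) x(3) prefix_max_Suc[of n "xs @ [x]"]
      by (cases "j = Suc n") (simp_all add: prefix_max_append nth_append)
  next
    fix a b v assume ab: "a < b" "b < Suc n" "(xs @ [x]) ! b < v" "v < (xs @ [x]) ! a"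
    show "v \<in> set (take b (xs @ [x]))"
    proof (cases "b = n")
      case True
      have "xs ! a \<le> m n" using ab True xs(1) by (intro bound) simp
      then show ?thesis
        using True ab xs(1) x(4)[of v] by (simp add: nth_append)
    next
      case False
      then show ?thesis
        using ab xs(1) xs(5)[of a b v] by (simp add: nth_append)
    qed
  qed
qed

lemma Av312_with_prefix_max:
  fixes m :: "nat \<Rightarrow> nat"
  assumes "m 0 = 0" "\<And>i. i < n \<Longrightarrow> m i \<le> m (Suc i)" "\<And>i. i \<le> n \<Longrightarrow> i \<le> m i" "m n = n"
  shows "\<exists>xs\<in>Av312 n. \<forall>j\<le>n. prefix_max xs j = m j"
proof -
  obtain xs where xs: "length xs = n" "distinct xs" "0 \<notin> set xs"
    "\<And>j. j \<le> n \<Longrightarrow> prefix_max xs j = m j"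
    "\<And>a b v. a < b \<Longrightarrow> b < n \<Longrightarrow> xs ! b < v \<Longrightarrow> v < xs ! a \<Longrightarrow> v \<in> set (take b xs)"
    using list_with_prefix_max[of m n] assms(1-3) by blast
  have "x \<le> n" if "x \<in> set xs" for x
    using le_prefix_max_length[OF that] xs(1) xs(4)[of n] assms(4) by simp
  then have "set xs \<subseteq> {1..n}"
    using xs(3) by (auto simp: Suc_le_eq intro: gr0I)
  then have "set xs = {1..n}"
    using xs(1,2) by (intro card_subset_eq) (auto simp: distinct_card)
  moreover have "avoids_312 xs"
    unfolding avoids_312_def
  proof clarify
    fix a b c assume abc: "a < b" "b < c" "c < length xs" "xs ! b < xs ! c" "xs ! c < xs ! a"
    \<comment> \<open>The third entry of a 312 pattern would have occurred before the second,
      against distinctness.\<close>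
    then have "xs ! c \<in> set (take b xs)" using xs(1,5) by simp
    then obtain j where "j < b" "xs ! j = xs ! c" by (auto simp: in_set_conv_nth)
    then show False using abc xs(2) by (simp add: nth_eq_iff_index_eq)
  qed
  ultimately have "xs \<in> Av312 n"
    using xs(2) by (simp add: Av312_def permutations_of_setI)
  then show ?thesis using xs(4) by blast
qed

section \<open>Hook configurations\<close>

lemma prefix_max_record:
  assumes "j < length xs" "prefix_max xs j < prefix_max xs (Suc j)" "l < j"
  shows "xs ! l < xs ! j"
  using prefix_max_ge[of l j xs] prefix_max_Suc[of j xs] assms by simp

lemma hook_curve_iff:
  "(x, y) \<in> hook_curve xs (i, j) \<longleftrightarrow>
     x = real i \<and> real (xs ! i) \<le> y \<and> y \<le> real (xs ! j) \<or>
     real i \<le> x \<and> x \<le> real j \<and> y = real (xs ! j)"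
  by (auto simp: hook_curve_def)

lemma hook_ends_iff:
  "p \<in> hook_ends xs (i, j) \<longleftrightarrow> p = (real i, real (xs ! i)) \<or> p = (real j, real (xs ! j))"
  by (auto simp: hook_ends_def plot_point_def)

lemma valid_hook_configD:
  assumes "valid_hook_config xs H" "(i, j) \<in> H"
  shows "i < j" "j < length xs" "xs ! i < xs ! j" "i \<in> descents xs"
    "\<And>l. i < l \<Longrightarrow> l < j \<Longrightarrow> xs ! l \<le> xs ! j"
proof -
  have "is_hook xs (i, j)" and fst: "fst ` H = descents xs"
    and above: "\<not> (\<exists>l. i < l \<and> l < j \<and> xs ! l > xs ! j)"
    using assms by (auto simp: valid_hook_config_def)
  then show "i < j" "j < length xs" "xs ! i < xs ! j"
    by (auto simp: is_hook_def)
  show "i \<in> descents xs" using fst assms(2) by force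
  show "i < l \<Longrightarrow> l < j \<Longrightarrow> xs ! l \<le> xs ! j" for l
    using above by (meson not_le)
qed

lemma valid_hook_config_disjoint:
  assumes "valid_hook_config xs H" "(i, j) \<in> H" "(i', j') \<in> H" "(i, j) \<noteq> (i', j')"
    and "p \<in> hook_curve xs (i, j)" "p \<in> hook_curve xs (i', j')"
  shows "p \<in> hook_ends xs (i, j)" "p \<in> hook_ends xs (i', j')"
proof -
  have "hook_curve xs (i, j) \<inter> hook_curve xs (i', j') \<subseteq> hook_ends xs (i, j) \<inter> hook_ends xs (i', j')"
    using assms(1-4) unfolding valid_hook_config_def by blast
  then show "p \<in> hook_ends xs (i, j)" "p \<in> hook_ends xs (i', j')" using assms(5,6) by auto
qed

text \<open>Each violation makes two curves meet in an explicit point that is not an endpoint of one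
  of the hooks.\<close>

lemma valid_hook_config_noncrossing:
  assumes "valid_hook_config xs H"
  shows "noncrossing_matching H"
proof -
  note D = valid_hook_configD[OF assms] and disj = valid_hook_config_disjoint[OF assms]
  \<comment> \<open>The corner of the lower hook lies on the vertical segment of the higher
    one.\<close>
  have sw: "\<not> xs ! j \<le> xs ! j'" if "(i, j) \<in> H" "(i, j') \<in> H" "j \<noteq> j'" for i j j'
  proof
    assume "xs ! j \<le> xs ! j'"
    then have "(real i, real (xs ! j)) \<in> hook_ends xs (i, j)"
      using disj(1)[of i j i j'] that D(1,3)[of i j] by (simp add: hook_curve_iff)
    then show False using D(1,3)[of i j] that by (auto simp: hook_ends_iff)
  qed
  \<comment> \<open>The corner of the inner hook lies on the horizontal segment of the outer
    one.\<close>
  have ne: "\<not> i < i'" if "(i, j) \<in> H" "(i', j) \<in> H" for i i' j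
  proof
    assume "i < i'"
    then have "(real i', real (xs ! j)) \<in> hook_ends xs (i, j)"
      using disj(1)[of i j i' j] that D(1,3)[of i' j] by (simp add: hook_curve_iff)
    then show False using \<open>i < i'\<close> D(1)[of i' j] that by (auto simp: hook_ends_iff)
  qed
  \<comment> \<open>Otherwise the hook from \<open>i'\<close> rises through the horizontal segment
    of the hook to \<open>j\<close>.\<close>
  have cross: "j' < j" if "(i, j) \<in> H" "(i', j') \<in> H" "i < i'" "i' < j" for i j i' j'
  proof (rule ccontr)
    assume "\<not> j' < j"
    moreover have "j \<noteq> j'" using ne that by blast
    ultimately have "xs ! j \<le> xs ! j'" using D(5)[of i' j' j] that by simp
    moreover have "xs ! i' \<le> xs ! j" using D(5)[of i j i'] that by simp
    ultimately have "(real i', real (xs ! j)) \<in> hook_ends xs (i, j)"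
      using disj(1)[of i j i' j'] that by (simp add: hook_curve_iff)
    then show False using that by (auto simp: hook_ends_iff)
  qed
  have "j = j'" if "(i, j) \<in> H" "(i, j') \<in> H" for i j j'
    using sw[of i j j'] sw[of i j' j] that by linarith
  then have "inj_on fst H" by (auto simp: inj_on_def)
  moreover have "i = i'" if "(i, j) \<in> H" "(i', j) \<in> H" for i i' j
    using ne[of i j i'] ne[of i' j i] that by linarith
  then have "inj_on snd H" by (auto simp: inj_on_def)
  ultimately show ?thesis
    using cross D(1) unfolding noncrossing_matching_def by blast
qed

text \<open>The SW endpoint is a descent top, so position \<open>j - 1\<close> lies strictly under
  the hook. Thus \<open>j - 1\<close> is no descent, and the running maximum grows at
  \<open>j\<close>.\<close>

lemma valid_hook_config_record:
  assumes "xs \<in> Av312 n" "valid_hook_config xs H" "j \<in> snd ` H"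
  shows "j < n \<and> prefix_max xs j < prefix_max xs (Suc j)"
proof -
  note xs = Av312D[OF assms(1)]
  obtain i where "(i, j) \<in> H" using assms(3) by auto
  note D = valid_hook_configD[OF assms(2) this]
  have "xs ! Suc i < xs ! i" using D(4) by (simp add: descents_def)
  then have "Suc i \<noteq> j" using D(3) by auto
  then obtain l where l: "j = Suc l" "i < l"
    using D(1) by (cases j) auto
  then have "xs ! l \<le> xs ! j" using D(5) by simp
  then have "l \<notin> descents xs" using l by (simp add: descents_def)
  then have "prefix_max xs (Suc j) \<noteq> prefix_max xs j"
    using descent_iff_prefix_max[OF assms(1), of l] D(2) xs(1) l by simp
  then show ?thesis using D(2) xs(1) prefix_max_Suc[of j xs] by simp
qed

text \<open>Records exceed everything before them, so no point lies above a hook, and a nested hook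
  runs strictly below the enclosing one.\<close>

lemma valid_hook_configI:
  assumes "xs \<in> Av312 n" "noncrossing_matching H" "fst ` H = descents xs"
    and peak: "\<And>j. j \<in> snd ` H \<Longrightarrow> j < n \<and> prefix_max xs j < prefix_max xs (Suc j)"
  shows "valid_hook_config xs H"
proof -
  note xs = Av312D[OF assms(1)]
  have less: "xs ! l < xs ! j" "j < n" if "(i, j) \<in> H" "l < j" for i j l
    using peak[of j] that prefix_max_record[of j xs l] xs(1) by force+
  have H: "inj_on fst H" "inj_on snd H"
    "\<And>i j. (i, j) \<in> H \<Longrightarrow> i < j"
    "\<And>i j i' j'. (i, j) \<in> H \<Longrightarrow> (i', j') \<in> H \<Longrightarrow> i < i' \<Longrightarrow> i' < j \<Longrightarrow> j' < j"
    using assms(2) unfolding noncrossing_matching_def by blast+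
  have ordered: "p \<in> hook_ends xs (i, j) \<inter> hook_ends xs (i', j')"
    if h: "(i, j) \<in> H" "(i', j') \<in> H" "i < i'"
      and p: "p \<in> hook_curve xs (i, j)" "p \<in> hook_curve xs (i', j')" for i j i' j' p
  proof -
    obtain x y where xy: "p = (x, y)" by (cases p)
    have ij: "i < j" "i' < j'" "xs ! i' < xs ! j'" using h H(3) less(1) by blast+
    \<comment> \<open>A common point is not left of \<open>i'\<close>, so it lies on the horizontal
      segment of the hook from \<open>i\<close>; without nesting only \<open>i' = j\<close>
      remains.\<close>
    have x: "real i' \<le> x" and y: "y \<le> real (xs ! j')"
      using p(2) ij unfolding xy hook_curve_iff by auto
    then have 1: "x \<le> real j" "y = real (xs ! j)"
      using p(1) h(3) ij unfolding xy hook_curve_iff by auto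
    have "\<not> i' < j"
    proof
      assume "i' < j"
      then have "j' < j" using H(4) h by blast
      then have "xs ! j' < xs ! j" using less(1) h by blast
      then show False using y 1 by simp
    qed
    then have "i' = j" "x = real j" using x 1 by auto
    then show ?thesis using 1 by (simp add: xy hook_ends_iff)
  qed
  have disj: "hook_curve xs h \<inter> hook_curve xs h' \<subseteq> hook_ends xs h \<inter> hook_ends xs h'"
    if h: "h \<in> H" "h' \<in> H" "h \<noteq> h'" for h h'
  proof
    fix p assume p: "p \<in> hook_curve xs h \<inter> hook_curve xs h'"
    obtain i j i' j' where eq: "h = (i, j)" "h' = (i', j')" by (metis surj_pair)
    have "i \<noteq> i'" using h H(1) eq by (metis fst_conv inj_onD)
    then consider "i < i'" | "i' < i" by linarith
    then show "p \<in> hook_ends xs h \<inter> hook_ends xs h'"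
      using ordered[of i j i' j' p] ordered[of i' j' i j p] p h unfolding eq by cases auto
  qed
  have "is_hook xs (i, j)" if "(i, j) \<in> H" for i j
    using that H(3) less[of i j i] xs(1) by (auto simp: is_hook_def)
  then have "\<forall>h\<in>H. is_hook xs h" by auto
  moreover have "\<forall>(i, j)\<in>H. \<not> (\<exists>l. i < l \<and> l < j \<and> xs ! l > xs ! j)"
    using less(1) by (fastforce dest: less_imp_le)
  ultimately show ?thesis
    using assms(3) disj unfolding valid_hook_config_def by blast
qed

section \<open>The bijection between reduced configurations and step lists\<close>

definition steps :: "nat list \<Rightarrow> nat set \<Rightarrow> (nat \<times> bool) list" where
  "steps xs T = map (\<lambda>i. (prefix_max xs (Suc i) - prefix_max xs i, i \<in> T)) [0..<length xs]"

lemma length_steps [simp]: "length (steps xs T) = length xs"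
  by (simp add: steps_def)

lemma nth_steps:
  "i < length xs \<Longrightarrow> steps xs T ! i = (prefix_max xs (Suc i) - prefix_max xs i, i \<in> T)"
  by (simp add: steps_def)

lemma height_take_Suc: "m < length e \<Longrightarrow> height (take (Suc m) e) = height (take m e) + fst (e ! m)"
  by (simp add: height_def take_Suc_conv_app_nth)

lemma marks_take: "m \<le> length e \<Longrightarrow> marks (take m e) = card {i. i < m \<and> snd (e ! i)}"
  by (auto simp: marks_def length_filter_conv_card intro!: arg_cong[of _ _ card])

lemma zeros_take: "m \<le> length e \<Longrightarrow> zeros (take m e) = card {i. i < m \<and> fst (e ! i) = 0}"
  by (auto simp: zeros_def length_filter_conv_card intro!: arg_cong[of _ _ card])

lemma height_steps: "m \<le> length xs \<Longrightarrow> height (take m (steps xs T)) = prefix_max xs m"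
proof (induction m)
  case (Suc m)
  then show ?case
    by (simp add: height_take_Suc nth_steps prefix_max_Suc)
qed (simp add: height_def)

lemma marks_steps: "m \<le> length xs \<Longrightarrow> marks (take m (steps xs T)) = card {t \<in> T. t < m}"
  by (auto simp: marks_take nth_steps intro!: arg_cong[of _ _ card])

lemma fst_steps_eq_0_iff:
  assumes "xs \<in> Av312 n" "i < n"
  shows "fst (steps xs T ! i) = 0 \<longleftrightarrow> i \<in> Suc ` descents xs"
proof (cases i)
  case 0
  note xs = Av312D[OF assms(1)]
  \<comment> \<open>The first entry raises the running maximum from 0, and position 0 is no descent
    bottom.\<close>
  have "1 \<le> prefix_max xs 1" using length_le_prefix_max[OF assms(1), of 1] assms(2) by simp
  then show ?thesis using 0 assms(2) xs(1) by (auto simp: nth_steps)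
next
  case (Suc j)
  note xs = Av312D[OF assms(1)]
  have "fst (steps xs T ! i) = 0 \<longleftrightarrow> prefix_max xs (Suc (Suc j)) = prefix_max xs (Suc j)"
    using assms(2) xs(1) Suc by (auto simp: nth_steps prefix_max_Suc)
  then show ?thesis
    using descent_iff_prefix_max[OF assms(1), of j] assms(2) Suc by auto
qed

lemma zeros_steps:
  assumes "xs \<in> Av312 n" "m \<le> n"
  shows "zeros (take m (steps xs T)) = card {i \<in> descents xs. Suc i < m}"
proof -
  have "zeros (take m (steps xs T)) = card {i. i < m \<and> i \<in> Suc ` descents xs}"
    using assms Av312D(1)[OF assms(1)] fst_steps_eq_0_iff[OF assms(1)]
    by (auto simp: zeros_take intro!: arg_cong[of _ _ card])
  also have "{i. i < m \<and> i \<in> Suc ` descents xs} = Suc ` {i \<in> descents xs. Suc i < m}"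
    by auto
  finally show ?thesis by (simp add: card_image)
qed

lemma finite_descents: "finite (descents xs)"
  by (rule finite_subset[of _ "{..<length xs}"]) (auto simp: descents_def)

lemma finite_noncrossing_matching:
  assumes "noncrossing_matching H" "fst ` H = descents xs"
  shows "finite H"
  using assms finite_descents[of xs] finite_image_iff[of fst H]
  by (simp add: noncrossing_matching_def)

lemma steps_in_step_lists:
  assumes "(xs, H) \<in> RedVHC k (Av312 n)"
  shows "steps xs (snd ` H) \<in> step_lists n k"
proof -
  have xs: "xs \<in> Av312 n" and valid: "valid_hook_config xs H"
    and red: "reduced_hook_config xs H" and k: "card H = k"
    using assms by (auto simp: RedVHC_def)
  note len = Av312D(1)[OF xs]
  have nc: "noncrossing_matching H" by (rule valid_hook_config_noncrossing[OF valid])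
  have fst: "fst ` H = descents xs" using valid by (simp add: valid_hook_config_def)
  have fin: "finite H" by (rule finite_noncrossing_matching[OF nc fst])
  have inj: "inj_on fst H" "inj_on snd H" using nc by (auto simp: noncrossing_matching_def)
  note peak = valid_hook_config_record[OF xs valid]
  let ?e = "steps xs (snd ` H)"
  have "{t \<in> snd ` H. t < n} = snd ` H" using peak by auto
  then have marks: "marks ?e = k"
    using marks_steps[of n xs "snd ` H"] len k inj by (simp add: card_image)
  have "{i \<in> descents xs. Suc i < n} = fst ` H" using fst len by (auto simp: descents_def)
  then have zeros: "zeros ?e = k"
    using zeros_steps[OF xs, of n "snd ` H"] len k inj by (simp add: card_image)
  have "marks (take m ?e) \<le> zeros (take m ?e)" if "m \<le> n" for m
    using that noncrossing_matching_ballot[OF fin nc, of m] len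
    by (simp add: marks_steps zeros_steps[OF xs] fst)
  moreover have "height ?e = n"
    using height_steps[of n xs] len prefix_max_full[OF xs] by simp
  ultimately have "adm 0 0 ?e"
    using marks zeros len length_le_prefix_max[OF xs] by (simp add: adm_def height_steps)
  moreover have "reduced_steps ?e"
    unfolding reduced_steps_def
  proof (intro allI impI conjI)
    fix i assume "i < length ?e"
    then have i: "i < n" using len by simp
    show "0 < fst (?e ! i)" if "snd (?e ! i)"
      using that i len peak[of i] by (simp add: nth_steps)
    assume "\<not> snd (?e ! i) \<and> 0 < fst (?e ! i)"
    then have "i \<notin> snd ` H" "i \<notin> Suc ` descents xs"
      using i len fst_steps_eq_0_iff[OF xs i, of "snd ` H"] by (simp_all add: nth_steps)
    \<comment> \<open>Being neither an NE endpoint nor a descent bottom, the point must be an SW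
      endpoint, hence a descent top.\<close>
    then have d: "i \<in> descents xs"
      using red fst i len by (auto simp: reduced_hook_config_def)
    then show "Suc i < length ?e" by (simp add: descents_def)
    then show "fst (?e ! Suc i) = 0"
      using d len by (subst fst_steps_eq_0_iff[OF xs]) auto
  qed
  ultimately show ?thesis
    using marks len by (simp add: step_lists_def)
qed

text \<open>The heights recover the permutation, the marks recover the NE endpoints, and the
  noncrossing matching of descents with NE endpoints is unique.\<close>

lemma steps_inject:
  assumes "(xs, H) \<in> RedVHC k (Av312 n)" "(ys, K) \<in> RedVHC k (Av312 n)"
    and eq: "steps xs (snd ` H) = steps ys (snd ` K)"
  shows "(xs, H) = (ys, K)"
proof -
  have xs: "xs \<in> Av312 n" and H: "valid_hook_config xs H"
    and ys: "ys \<in> Av312 n" and K: "valid_hook_config ys K"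
    using assms by (auto simp: RedVHC_def)
  note len = Av312D(1)[OF xs] Av312D(1)[OF ys]
  have "prefix_max xs i = prefix_max ys i" if "i \<le> n" for i
    using height_steps[of i xs "snd ` H"] height_steps[of i ys "snd ` K"] that len eq by simp
  then have xy: "xs = ys" by (rule Av312_eq_if_prefix_max_eq[OF xs ys])
  have "i \<in> snd ` H \<longleftrightarrow> i \<in> snd ` K" if "i < n" for i
    using arg_cong[OF eq, of "\<lambda>e. snd (e ! i)"] that len by (simp add: nth_steps)
  then have snd: "snd ` H = snd ` K"
    using valid_hook_config_record[OF xs H] valid_hook_config_record[OF ys K] by blast
  have fst: "fst ` H = descents xs" "fst ` K = descents xs"
    using H K xy by (simp_all add: valid_hook_config_def)
  have nc: "noncrossing_matching H" "noncrossing_matching K"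
    using H K valid_hook_config_noncrossing by auto
  have "H = K"
    using finite_noncrossing_matching[OF nc(1) fst(1)] fst snd nc
    by (intro noncrossing_matching_unique) auto
  then show ?thesis using xy by simp
qed

text \<open>The heights prescribe the running maximum of a permutation, and the ballot condition on
  the marks allows bracket matching with its descents.\<close>

lemma steps_surj:
  assumes "e \<in> step_lists n k"
  shows "\<exists>xs H. (xs, H) \<in> RedVHC k (Av312 n) \<and> e = steps xs (snd ` H)"
proof -
  have e: "length e = n" "adm 0 0 e" "marks e = k" "reduced_steps e"
    using assms by (auto simp: step_lists_def)
  define m where "m i = height (take i e)" for i
  define T where "T = {i. i < n \<and> snd (e ! i)}"
  have "\<exists>xs\<in>Av312 n. \<forall>j\<le>n. prefix_max xs j = m j"
  proof (rule Av312_with_prefix_max)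
    show "m 0 = 0" by (simp add: m_def height_def)
    show "m i \<le> m (Suc i)" if "i < n" for i
      using that e(1) by (simp add: m_def height_take_Suc)
    show "i \<le> m i" if "i \<le> n" for i
      using that e(1,2) by (simp add: m_def adm_def)
    show "m n = n" using e(1,2) by (simp add: m_def adm_def)
  qed
  then obtain xs where xs: "xs \<in> Av312 n" and max: "\<And>j. j \<le> n \<Longrightarrow> prefix_max xs j = m j"
    by blast
  note len = Av312D(1)[OF xs]
  have eq: "e = steps xs T"
  proof (rule nth_equalityI)
    show "length e = length (steps xs T)" using e(1) len by simp
    fix i assume "i < length e"
    then show "e ! i = steps xs T ! i"
      using e(1) len max[of i] max[of "Suc i"] height_take_Suc[of i e]
      by (simp add: nth_steps T_def m_def prod_eq_iff)
  qed
  have zero: "fst (e ! i) = 0 \<longleftrightarrow> i \<in> Suc ` descents xs" if "i < n" for i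
    unfolding eq by (rule fst_steps_eq_0_iff[OF xs that])
  have cardT: "card T = k"
    using marks_take[of n e] e(1,3) by (simp add: T_def)
  have "{i \<in> descents xs. Suc i < n} = descents xs" using len by (auto simp: descents_def)
  then have "card (descents xs) = zeros e"
    using zeros_steps[OF xs, of n T] e(1) by (simp flip: eq)
  then have cardD: "card (descents xs) = card T"
    using e(2,3) cardT by (simp add: adm_def)
  have "\<exists>H. noncrossing_matching H \<and> fst ` H = descents xs \<and> snd ` H = T"
  proof (rule noncrossing_matching_exists)
    show "finite (descents xs)" "finite T" "card (descents xs) = card T"
      using cardD by (simp_all add: finite_descents T_def)
    fix j assume j: "j \<in> T"
    then have "j < n" by (simp add: T_def)
    \<comment> \<open>In the prefix of length \<open>Suc j\<close> the marks are those up to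
      \<open>j\<close>, and the zeros are the bottoms of descents before \<open>j\<close>.\<close>
    then have "marks (take (Suc j) e) \<le> zeros (take (Suc j) e)"
      using e(1,2) by (simp add: adm_def)
    then show "card {t \<in> T. t \<le> j} \<le> card {i \<in> descents xs. i < j}"
      using \<open>j < n\<close> marks_steps[of "Suc j" xs T] zeros_steps[OF xs, of "Suc j" T] len
      by (simp add: less_Suc_eq_le Suc_le_eq flip: eq)
  qed
  then obtain H where H: "noncrossing_matching H" "fst ` H = descents xs" "snd ` H = T" by blast
  have "valid_hook_config xs H"
  proof (rule valid_hook_configI[OF xs H(1,2)])
    fix j assume "j \<in> snd ` H"
    then have "j < n" "snd (e ! j)" using H(3) by (auto simp: T_def)
    moreover from this have "0 < fst (e ! j)"
      using e(1,4) by (auto simp: reduced_steps_def)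
    ultimately show "j < n \<and> prefix_max xs j < prefix_max xs (Suc j)"
      using len by (simp add: eq nth_steps)
  qed
  moreover have "reduced_hook_config xs H"
    unfolding reduced_hook_config_def H(2,3)
  proof (intro allI impI)
    fix i assume "i < length xs"
    then have i: "i < n" using len by simp
    show "i \<in> descents xs \<or> i \<in> T \<or> i \<in> Suc ` descents xs"
    proof (rule ccontr)
      assume "\<not> ?thesis"
      then have no: "i \<notin> descents xs" "i \<notin> T" "i \<notin> Suc ` descents xs" by auto
      then have "\<not> snd (e ! i)" "0 < fst (e ! i)"
        using i zero[OF i] by (auto simp: T_def)
      then have "Suc i < n" "fst (e ! Suc i) = 0"
        using e(1,4) i by (auto simp: reduced_steps_def)
      then have "i \<in> descents xs" using zero[of "Suc i"] by auto
      then show False using no by blast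
    qed
  qed
  moreover have "card H = k"
    using H(1,3) cardT by (metis card_image noncrossing_matching_def)
  ultimately have "(xs, H) \<in> RedVHC k (Av312 n)"
    using xs by (simp add: RedVHC_def)
  then show ?thesis using eq H(3) by blast
qed

lemma card_RedVHC: "card (RedVHC k (Av312 n)) = card {w \<in> words k. 2 * k + tops w = n}"
proof -
  have "bij_betw (\<lambda>(xs, H). steps xs (snd ` H)) (RedVHC k (Av312 n)) (step_lists n k)"
    unfolding bij_betw_def
  proof
    show "inj_on (\<lambda>(xs, H). steps xs (snd ` H)) (RedVHC k (Av312 n))"
      by (rule inj_onI) (clarify, metis steps_inject prod.inject)
    show "(\<lambda>(xs, H). steps xs (snd ` H)) ` RedVHC k (Av312 n) = step_lists n k"
      using steps_in_step_lists steps_surj by (fastforce simp: image_iff)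
  qed
  then show ?thesis
    by (simp add: bij_betw_same_card card_step_lists)
qed

theorem corollary5p1p2:
  fixes k :: nat
  assumes "k \<ge> 1"
  shows "poly (f_poly k) (-1) =
           (\<Sum>i=0..k-1. (-1) ^ i * real (card (RedVHC k (Av312 (3 * k - i))))) \<and>
         (\<Sum>i=0..k-1. (-1) ^ i * real (card (RedVHC k (Av312 (3 * k - i))))) =
           catalan_number k"
  using alternating_sum_words[OF assms]
  by (simp add: f_poly_def poly_sum poly_monom card_RedVHC mult.commute)

end
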